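(* Let $a,b,c,d\in\mathcal M_n$ be such that each of $a,b$ alternates strongly with each of $c,d$, $(a,b)(c,d)=0$ in $\mathcal M_{n+1}$, and $n(a)=n(b)=n(c)=n(d)=1$. Consider the following six pairs ("corners") of elements of $\mathcal M_{n+1}$, in cyclic order: $$V_1=\{(a,b),(b,-a)\},\quad V_2=\{(c,d),(d,-c)\},\quad V_3=\{(ac,ad),(ad,-ac)\},$$ $$V_4=\{(a,-b),(b,a)\},\quad V_5=\{(c,-d),(d,c)\},\quad V_6=\{(ac,-ad),(ad,ac)\}.$$ Then these elements represent $12$ distinct vertices of the orthogonality graph $\Gamma_O(\mathcal M_{n+1})$, and for each $i\in\mathbb Z/6$ every element of $V_i$ is orthogonal to every element of $V_{i+1}$. Thus they form a subgraph of $\Gamma_O(\mathcal M_{n+1})$ (called a double hexagon) which consists of six complete bipartite graphs $K_{2,2}$, on the vertex sets $V_i\cup V_{i+1}$, glued together cyclically.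
   Context: The algebras of the main sequence: $\mathcal M_0=\mathbb R$ with trivial involution, and $\mathcal M_{k+1}=\mathcal M_k\times\mathcal M_k$ with componentwise addition and real scaling, product $(a,b)(c,d)=(ac-\bar d b,\ da+b\bar c)$ and involution $\overline{(a,b)}=(\bar a,-b)$. The norm is $n(a)=a\bar a\in\mathbb R$. Two elements $x,y$ alternate strongly if $(xx)y=x(xy)$ and $(yy)x=y(yx)$. Elements $x,y$ are orthogonal if $xy=yx=0$. The orthogonality graph $\Gamma_O(\mathcal A)$ has as vertices the lines $[x]=\mathbb R x$ through two-sided zero divisors $x\neq0$; distinct vertices $[x],[y]$ are adjacent iff $xy=yx=0$. A nonzero element is identified with the line through it. *)

theory Defs
  imports Complex_Main "Graph_Theory.Kuratowski"
begin

text \<open>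
  All algebras of the sequence live in one type of binary trees; the elements of the \<open>n\<close>-th algebra
  are the full trees of depth \<open>n\<close>. Binary operations on trees of different shape are unspecified.
\<close>

datatype cd = Scalar real | Dbl cd cd  (\<open>\<langle>_,/ _\<rangle>\<close>)

primrec main_seq :: "nat \<Rightarrow> cd set"  (\<open>\<M>\<close>) where
  "\<M> 0 = range Scalar"
| "\<M> (Suc n) = {\<langle>a, b\<rangle> | a b. a \<in> \<M> n \<and> b \<in> \<M> n}"

instantiation cd :: "{plus, uminus, minus, scaleR}"
begin

fun plus_cd :: "cd \<Rightarrow> cd \<Rightarrow> cd" where
  "Scalar r + Scalar s = Scalar (r + s)"
| "\<langle>a, b\<rangle> + \<langle>c, d\<rangle> = \<langle>a + c, b + d\<rangle>"

fun uminus_cd :: "cd \<Rightarrow> cd" where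
  "- Scalar r = Scalar (- r)"
| "- \<langle>a, b\<rangle> = \<langle>- a, - b\<rangle>"

fun minus_cd :: "cd \<Rightarrow> cd \<Rightarrow> cd" where
  "Scalar r - Scalar s = Scalar (r - s)"
| "\<langle>a, b\<rangle> - \<langle>c, d\<rangle> = \<langle>a - c, b - d\<rangle>"

fun scaleR_cd :: "real \<Rightarrow> cd \<Rightarrow> cd" where
  "r *\<^sub>R Scalar s = Scalar (r * s)"
| "r *\<^sub>R \<langle>a, b\<rangle> = \<langle>r *\<^sub>R a, r *\<^sub>R b\<rangle>"

instance ..

end

fun cd_conj :: "cd \<Rightarrow> cd" where
  "cd_conj (Scalar r) = Scalar r"
| "cd_conj \<langle>a, b\<rangle> = \<langle>cd_conj a, - b\<rangle>"

lemma size_uminus_cd [simp]: "size (- x :: cd) = size x"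
  by (induction x) simp_all

lemma size_cd_conj [simp]: "size (cd_conj x) = size x"
  by (induction x) simp_all

instantiation cd :: times
begin

function times_cd :: "cd \<Rightarrow> cd \<Rightarrow> cd" where
  "Scalar r * Scalar s = Scalar (r * s)"
| "\<langle>a, b\<rangle> * \<langle>c, d\<rangle> = \<langle>a * c - cd_conj d * b, d * a + b * cd_conj c\<rangle>"
| "Scalar r * \<langle>c, d\<rangle> = undefined"
| "\<langle>a, b\<rangle> * Scalar s = undefined"
  by pat_completeness auto
termination
  by (relation "measure (\<lambda>(x, y). size x + size y)") auto

instance ..

end

text \<open>The embedding of the reals as \<open>\<real> \<cdot> 1\<close> in the \<open>n\<close>-th algebra; it provides its zero and unit.\<close>

primrec cd_scalar :: "nat \<Rightarrow> real \<Rightarrow> cd" where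
  "cd_scalar 0 r = Scalar r"
| "cd_scalar (Suc n) r = \<langle>cd_scalar n r, cd_scalar n 0\<rangle>"

abbreviation cd_zero :: "nat \<Rightarrow> cd"  (\<open>\<zero>\<^bsub>_\<^esub>\<close>) where
  "\<zero>\<^bsub>n\<^esub> \<equiv> cd_scalar n 0"

abbreviation cd_one :: "nat \<Rightarrow> cd"  (\<open>\<one>\<^bsub>_\<^esub>\<close>) where
  "\<one>\<^bsub>n\<^esub> \<equiv> cd_scalar n 1"

text \<open>
  The norm of an element of the \<open>n\<close>-th algebra is kept as an element of that algebra, so that norm
  one reads \<open>cd_norm a = \<one>\<^bsub>n\<^esub>\<close>.
\<close>

definition cd_norm :: "cd \<Rightarrow> cd" where
  "cd_norm a = a * cd_conj a"

definition alternate_strongly :: "cd \<Rightarrow> cd \<Rightarrow> bool" where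
  "alternate_strongly x y \<longleftrightarrow> (x * x) * y = x * (x * y) \<and> (y * y) * x = y * (y * x)"

definition cd_orthogonal :: "nat \<Rightarrow> cd \<Rightarrow> cd \<Rightarrow> bool" where
  "cd_orthogonal n x y \<longleftrightarrow> x * y = \<zero>\<^bsub>n\<^esub> \<and> y * x = \<zero>\<^bsub>n\<^esub>"

definition two_sided_zero_divisor :: "nat \<Rightarrow> cd \<Rightarrow> bool" where
  "two_sided_zero_divisor n x \<longleftrightarrow> x \<in> \<M> n \<and> x \<noteq> \<zero>\<^bsub>n\<^esub> \<and>
     (\<exists>y \<in> \<M> n. y \<noteq> \<zero>\<^bsub>n\<^esub> \<and> x * y = \<zero>\<^bsub>n\<^esub>) \<and>
     (\<exists>z \<in> \<M> n. z \<noteq> \<zero>\<^bsub>n\<^esub> \<and> z * x = \<zero>\<^bsub>n\<^esub>)"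

definition cd_line :: "cd \<Rightarrow> cd set" where
  "cd_line x = {r *\<^sub>R x | r. True}"

text \<open>Undirected graphs are represented, as in \<open>Graph_Theory\<close>, by symmetric digraphs.\<close>

definition orthogonality_graph :: "nat \<Rightarrow> cd set pair_pre_digraph"  (\<open>\<Gamma>\<^sub>O\<close>) where
  "\<Gamma>\<^sub>O n = \<lparr>
     pverts = {cd_line x | x. two_sided_zero_divisor n x},
     parcs = {(cd_line x, cd_line y) | x y.
       two_sided_zero_divisor n x \<and> two_sided_zero_divisor n y \<and>
       cd_line x \<noteq> cd_line y \<and> cd_orthogonal n x y} \<rparr>"

definition bipartite_join :: "'v set \<Rightarrow> 'v set \<Rightarrow> 'v pair_pre_digraph" where
  "bipartite_join U W = \<lparr> pverts = U \<union> W, parcs = U \<times> W \<union> W \<times> U \<rparr>"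

definition double_hexagon :: "(nat \<Rightarrow> 'v set) \<Rightarrow> 'v pair_pre_digraph" where
  "double_hexagon W = \<lparr>
     pverts = (\<Union>i<6. pverts (bipartite_join (W i) (W (Suc i mod 6)))),
     parcs = (\<Union>i<6. parcs (bipartite_join (W i) (W (Suc i mod 6)))) \<rparr>"

definition corners :: "cd \<Rightarrow> cd \<Rightarrow> cd \<Rightarrow> cd \<Rightarrow> cd list list" where
  "corners a b c d =
    [[\<langle>a, b\<rangle>, \<langle>b, - a\<rangle>],
     [\<langle>c, d\<rangle>, \<langle>d, - c\<rangle>],
     [\<langle>a * c, a * d\<rangle>, \<langle>a * d, - (a * c)\<rangle>],
     [\<langle>a, - b\<rangle>, \<langle>b, a\<rangle>],
     [\<langle>c, - d\<rangle>, \<langle>d, c\<rangle>],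
     [\<langle>a * c, - (a * d)\<rangle>, \<langle>a * d, a * c\<rangle>]]"

end

theory Submission
  imports Defs
begin

text \<open>
  Let \<open>(a, b)(c, d) = 0\<close>. Associativity of the trace form forces all four components to be imaginary,
  and strong alternation turns the zero product into a full multiplication table for the six elements
  \<open>a, b, c, d, ac, ad\<close>, up to signs. These six elements are moreover orthonormal for the
  inner product \<open>(\<cdot> | \<cdot>)\<close> of the norm: \<open>(a | c)\<close> equals its own negative by two evaluations of
  \<open>((ad)d | c) = ((cb)d | c)\<close>, and \<open>(c | d) = (ac | ad) = - (bd | bc) = - (c | d)\<close>. The orthogonality relations can then be
  read off the table, and the twelve vertices are distinct because they are pairwise perpendicular.
\<close>

subsection \<open>Arithmetic in the main sequence\<close>

lemma cd_scalar_mem [simp]: "cd_scalar n r \<in> \<M> n"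
  by (induction n arbitrary: r) auto

lemma cd_add_mem: "x \<in> \<M> n \<Longrightarrow> y \<in> \<M> n \<Longrightarrow> x + y \<in> \<M> n"
  by (induction n arbitrary: x y) auto

lemma cd_diff_mem: "x \<in> \<M> n \<Longrightarrow> y \<in> \<M> n \<Longrightarrow> x - y \<in> \<M> n"
  by (induction n arbitrary: x y) auto

lemma cd_uminus_mem: "x \<in> \<M> n \<Longrightarrow> - x \<in> \<M> n"
  by (induction n arbitrary: x) auto

lemma cd_conj_mem: "x \<in> \<M> n \<Longrightarrow> cd_conj x \<in> \<M> n"
  by (induction n arbitrary: x) (auto simp: cd_uminus_mem)

lemma cd_mult_mem: "x \<in> \<M> n \<Longrightarrow> y \<in> \<M> n \<Longrightarrow> x * y \<in> \<M> n"
  by (induction n arbitrary: x y) (auto simp: cd_conj_mem cd_add_mem cd_diff_mem)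

lemmas cd_mem = cd_add_mem cd_diff_mem cd_uminus_mem cd_conj_mem cd_mult_mem

lemma cd_minus_minus [simp]: "- (- x) = (x :: cd)"
  by (induction x) auto

lemma cd_minus_inject [simp]: "- x = - y \<longleftrightarrow> x = (y :: cd)"
  by (metis cd_minus_minus)

lemma cd_conj_minus [simp]: "cd_conj (- x) = - cd_conj x"
  by (induction x) auto

lemma cd_conj_conj [simp]: "cd_conj (cd_conj x) = x"
  by (induction x) auto

lemma cd_scalar_inject: "cd_scalar n r = cd_scalar n s \<longleftrightarrow> r = s"
  by (induction n arbitrary: r s) auto

lemma cd_scalar_minus [simp]: "- cd_scalar n r = cd_scalar n (- r)"
  by (induction n arbitrary: r) auto

lemma cd_scalar_conj [simp]: "cd_conj (cd_scalar n r) = cd_scalar n r"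
  by (induction n arbitrary: r) auto

lemma cd_scalar_add [simp]: "cd_scalar n r + cd_scalar n s = cd_scalar n (r + s)"
  by (induction n arbitrary: r s) auto

lemma cd_scalar_diff [simp]: "cd_scalar n r - cd_scalar n s = cd_scalar n (r - s)"
  by (induction n arbitrary: r s) auto

lemma cd_add_commute: "x \<in> \<M> n \<Longrightarrow> y \<in> \<M> n \<Longrightarrow> x + y = y + x"
  by (induction n arbitrary: x y) auto

lemma cd_add_zero: "x \<in> \<M> n \<Longrightarrow> x + \<zero>\<^bsub>n\<^esub> = x"
  by (induction n arbitrary: x) auto

lemma cd_zero_add: "x \<in> \<M> n \<Longrightarrow> \<zero>\<^bsub>n\<^esub> + x = x"
  by (induction n arbitrary: x) auto

lemma cd_diff_zero: "x \<in> \<M> n \<Longrightarrow> x - \<zero>\<^bsub>n\<^esub> = x"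
  by (induction n arbitrary: x) auto

lemma cd_add_minus: "x \<in> \<M> n \<Longrightarrow> y \<in> \<M> n \<Longrightarrow> x + - y = x - y"
  by (induction n arbitrary: x y) auto

lemma cd_diff_minus: "x \<in> \<M> n \<Longrightarrow> y \<in> \<M> n \<Longrightarrow> x - - y = x + y"
  by (induction n arbitrary: x y) auto

lemma cd_minus_add: "x \<in> \<M> n \<Longrightarrow> y \<in> \<M> n \<Longrightarrow> - (x + y) = - x + - y"
  by (induction n arbitrary: x y) auto

lemma cd_minus_diff: "x \<in> \<M> n \<Longrightarrow> y \<in> \<M> n \<Longrightarrow> - (x - y) = - x + y"
  by (induction n arbitrary: x y) auto

lemma cd_diff_eq_zero: "x \<in> \<M> n \<Longrightarrow> y \<in> \<M> n \<Longrightarrow> x - y = \<zero>\<^bsub>n\<^esub> \<longleftrightarrow> x = y"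
  by (induction n arbitrary: x y) auto

lemma cd_add_eq_zero: "x \<in> \<M> n \<Longrightarrow> y \<in> \<M> n \<Longrightarrow> x + y = \<zero>\<^bsub>n\<^esub> \<longleftrightarrow> x = - y"
  by (metis cd_add_minus cd_diff_eq_zero cd_minus_minus cd_uminus_mem)

lemma cd_conj_diff: "x \<in> \<M> n \<Longrightarrow> y \<in> \<M> n \<Longrightarrow> cd_conj (x - y) = cd_conj x - cd_conj y"
proof (induction n arbitrary: x y)
  case (Suc n)
  then show ?case
    by (auto simp: cd_minus_diff[where n = n] cd_diff_minus[where n = n] cd_uminus_mem)
qed auto

text \<open>Both sign rules share one induction: the doubling product puts a component of the left
  factor on the right in \<open>d * a\<close> and \<open>cd_conj d * b\<close>, so each rule needs
  the other at the level below.\<close>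

lemma cd_mult_minus:
  assumes "x \<in> \<M> n" "y \<in> \<M> n"
  shows "- x * y = - (x * y)" "x * - y = - (x * y)"
proof -
  have "- x * y = - (x * y) \<and> x * - y = - (x * y)" using assms
  proof (induction n arbitrary: x y)
    case (Suc n)
    then show ?case
      by (auto simp: cd_mem cd_minus_add[where n = n] cd_minus_diff[where n = n] cd_diff_minus[where n = n])
  qed auto
  then show "- x * y = - (x * y)" "x * - y = - (x * y)" by auto
qed

lemma cd_mult_zero:
  assumes "x \<in> \<M> n"
  shows "\<zero>\<^bsub>n\<^esub> * x = \<zero>\<^bsub>n\<^esub>" "x * \<zero>\<^bsub>n\<^esub> = \<zero>\<^bsub>n\<^esub>"
proof -
  have "\<zero>\<^bsub>n\<^esub> * x = \<zero>\<^bsub>n\<^esub> \<and> x * \<zero>\<^bsub>n\<^esub> = \<zero>\<^bsub>n\<^esub>" using assms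
    by (induction n arbitrary: x) (auto simp: cd_conj_mem)
  then show "\<zero>\<^bsub>n\<^esub> * x = \<zero>\<^bsub>n\<^esub>" "x * \<zero>\<^bsub>n\<^esub> = \<zero>\<^bsub>n\<^esub>" by auto
qed

lemma cd_mult_one:
  assumes "x \<in> \<M> n"
  shows "\<one>\<^bsub>n\<^esub> * x = x" "x * \<one>\<^bsub>n\<^esub> = x"
proof -
  have "\<one>\<^bsub>n\<^esub> * x = x \<and> x * \<one>\<^bsub>n\<^esub> = x" using assms
    by (induction n arbitrary: x)
      (auto simp: cd_conj_mem cd_mult_zero cd_add_zero cd_zero_add cd_diff_zero)
  then show "\<one>\<^bsub>n\<^esub> * x = x" "x * \<one>\<^bsub>n\<^esub> = x" by auto
qed

lemma cd_conj_mult: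
  "x \<in> \<M> n \<Longrightarrow> y \<in> \<M> n \<Longrightarrow> cd_conj (x * y) = cd_conj y * cd_conj x"
proof (induction n arbitrary: x y)
  case (Suc n)
  then show ?case
    by (auto simp: cd_mem cd_conj_diff[where n = n] cd_minus_add[where n = n] cd_mult_minus[where n = n])
      (rule cd_add_commute[where n = n]; simp add: cd_mem)
qed auto


subsection \<open>The norm form\<close>

text \<open>The Euclidean inner product of coordinates; \<open>cd_mult_conj\<close> identifies it as
  the polar form of the norm. The default 0 for mismatched shapes keeps symmetry, signs and scaling
  free of membership hypotheses.\<close>

fun cd_inner :: "cd \<Rightarrow> cd \<Rightarrow> real" where
  "cd_inner (Scalar r) (Scalar s) = r * s"
| "cd_inner \<langle>a, b\<rangle> \<langle>c, d\<rangle> = cd_inner a c + cd_inner b d"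
| "cd_inner _ _ = 0"

primrec cd_re :: "cd \<Rightarrow> real" where
  "cd_re (Scalar r) = r"
| "cd_re \<langle>a, b\<rangle> = cd_re a"

lemma cd_inner_commute: "cd_inner x y = cd_inner y x"
  by (induction x y rule: cd_inner.induct) auto

lemma cd_inner_minus [simp]:
  "cd_inner (- x) y = - cd_inner x y" "cd_inner x (- y) = - cd_inner x y"
  by (induction x y rule: cd_inner.induct) auto

lemma cd_inner_scaleR_left: "cd_inner (r *\<^sub>R x) y = r * cd_inner x y"
  by (induction x y rule: cd_inner.induct) (auto simp: algebra_simps)

lemma cd_inner_conj: "cd_inner (cd_conj x) (cd_conj y) = cd_inner x y"
  by (induction x y rule: cd_inner.induct) auto

lemma cd_inner_add_left:
  "x \<in> \<M> n \<Longrightarrow> y \<in> \<M> n \<Longrightarrow> z \<in> \<M> n \<Longrightarrow> cd_inner (x + y) z = cd_inner x z + cd_inner y z"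
  by (induction n arbitrary: x y z) (auto simp: algebra_simps)

lemma cd_inner_diff_left:
  "x \<in> \<M> n \<Longrightarrow> y \<in> \<M> n \<Longrightarrow> z \<in> \<M> n \<Longrightarrow> cd_inner (x - y) z = cd_inner x z - cd_inner y z"
  by (induction n arbitrary: x y z) (auto simp: algebra_simps)

lemma cd_inner_scalar: "x \<in> \<M> n \<Longrightarrow> cd_inner x (cd_scalar n r) = r * cd_re x"
  by (induction n arbitrary: x r) auto

text \<open>The involution fixes the first coordinate and negates all others. Below, "imaginary" is
  used as an equation and proved through the real part.\<close>

lemma cd_conj_eq_minus_iff: "cd_conj x = - x \<longleftrightarrow> cd_re x = 0"
  by (induction x) auto

lemma cd_re_conj [simp]: "cd_re (cd_conj x) = cd_re x"
  by (induction x) auto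

lemma cd_re_minus [simp]: "cd_re (- x) = - cd_re x"
  by (induction x) auto

text \<open>The substitute for associativity: multiplication by an element and by its conjugate are
  adjoint. Only the left rule is proved by induction; the right rule follows from it because the
  involution is an isometric antiautomorphism.\<close>

lemma cd_inner_mult_adjoint:
  assumes "x \<in> \<M> n" "y \<in> \<M> n" "z \<in> \<M> n"
  shows "cd_inner (x * y) z = cd_inner y (cd_conj x * z)"
    and "cd_inner (x * y) z = cd_inner x (z * cd_conj y)"
proof -
  have left: "cd_inner (x * y) z = cd_inner y (cd_conj x * z)"
    if "x \<in> \<M> n" "y \<in> \<M> n" "z \<in> \<M> n" for x y z
    using that
  proof (induction n arbitrary: x y z)
    case (Suc n)
    \<comment> \<open>The doubling product multiplies from both sides, so the right rule at level
      \<open>n\<close> is needed within the induction step.\<close>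
    have right: "cd_inner (x * y) z = cd_inner x (z * cd_conj y)"
      if "x \<in> \<M> n" "y \<in> \<M> n" "z \<in> \<M> n" for x y z
    proof -
      have "cd_inner (x * y) z = cd_inner (cd_conj y * cd_conj x) (cd_conj z)"
        using that by (metis cd_inner_conj cd_conj_mult)
      also have "\<dots> = cd_inner (cd_conj x) (y * cd_conj z)"
        using Suc.IH[of "cd_conj y" "cd_conj x" "cd_conj z"] that by (simp add: cd_mem)
      also have "\<dots> = cd_inner x (z * cd_conj y)"
        using that cd_inner_conj[of x "z * cd_conj y"] cd_conj_mult[of z n "cd_conj y"]
        by (simp add: cd_mem)
      finally show ?thesis .
    qed
    obtain a b c d e f where xyz: "x = \<langle>a, b\<rangle>" "y = \<langle>c, d\<rangle>" "z = \<langle>e, f\<rangle>"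
      and mem: "a \<in> \<M> n" "b \<in> \<M> n" "c \<in> \<M> n" "d \<in> \<M> n" "e \<in> \<M> n" "f \<in> \<M> n"
      using Suc.prems by auto
    \<comment> \<open>The left side expands into four terms; in each, the component \<open>c\<close>
      or \<open>d\<close> of \<open>y\<close> is isolated.\<close>
    have 1: "cd_inner (a * c) e = cd_inner c (cd_conj a * e)"
      using mem by (simp add: Suc.IH)
    have 2: "cd_inner (cd_conj d * b) e = cd_inner d (b * cd_conj e)"
    proof -
      have "cd_inner (cd_conj d * b) e = cd_inner (cd_conj d) (e * cd_conj b)"
        using mem by (simp add: right cd_mem)
      also have "\<dots> = cd_inner d (b * cd_conj e)"
        using mem cd_inner_conj[of "cd_conj d" "e * cd_conj b"] cd_conj_mult[of e n "cd_conj b"]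
        by (simp add: cd_mem)
      finally show ?thesis .
    qed
    have 3: "cd_inner (d * a) f = cd_inner d (f * cd_conj a)"
      using mem by (simp add: right)
    have 4: "cd_inner (b * cd_conj c) f = cd_inner c (cd_conj f * b)"
    proof -
      have "cd_inner (b * cd_conj c) f = cd_inner (cd_conj c) (cd_conj b * f)"
        using mem by (simp add: Suc.IH cd_mem)
      also have "\<dots> = cd_inner c (cd_conj f * b)"
        using mem cd_inner_conj[of "cd_conj c" "cd_conj b * f"] cd_conj_mult[of "cd_conj b" n f]
        by (simp add: cd_mem)
      finally show ?thesis .
    qed
    show ?case
      using mem 1 2 3 4
      by (simp add: xyz cd_mem cd_mult_minus[where n = n] cd_diff_minus[where n = n] cd_add_minus[where n = n]
          cd_inner_add_left[where n = n] cd_inner_diff_left[where n = n] cd_inner_commute[of c]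
          cd_inner_commute[of d])
  qed auto
  then show "cd_inner (x * y) z = cd_inner y (cd_conj x * z)"
    using assms by blast
  have "cd_inner (x * y) z = cd_inner (cd_conj y * cd_conj x) (cd_conj z)"
    using assms by (metis cd_inner_conj cd_conj_mult)
  also have "\<dots> = cd_inner (cd_conj x) (y * cd_conj z)"
    using left[of "cd_conj y" "cd_conj x" "cd_conj z"] assms by (simp add: cd_mem)
  also have "\<dots> = cd_inner x (z * cd_conj y)"
    using assms cd_inner_conj[of x "z * cd_conj y"] cd_conj_mult[of z n "cd_conj y"]
    by (simp add: cd_mem)
  finally show "cd_inner (x * y) z = cd_inner x (z * cd_conj y)" .
qed

text \<open>For a pair (a, b) the second component is - b a + b a = 0, and the first is the norm of
  \<open>a\<close> plus that of \<open>cd_conj b\<close>.\<close>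

lemma cd_mult_conj: "x \<in> \<M> n \<Longrightarrow> x * cd_conj x = cd_scalar n (cd_inner x x)"
proof (induction n arbitrary: x)
  case (Suc n)
  then obtain a b where x: "x = \<langle>a, b\<rangle>" and mem: "a \<in> \<M> n" "b \<in> \<M> n" by auto
  have "cd_conj b * b = cd_scalar n (cd_inner b b)"
    using Suc.IH[of "cd_conj b"] mem by (simp add: cd_mem cd_inner_conj)
  then show ?case
    using mem Suc.IH[of a]
    by (simp add: x cd_mem cd_mult_minus[where n = n] cd_diff_minus[where n = n] cd_add_eq_zero[where n = n])
qed auto

lemma cd_conj_mult_self: "x \<in> \<M> n \<Longrightarrow> cd_conj x * x = cd_scalar n (cd_inner x x)"
  using cd_mult_conj[of "cd_conj x" n] by (simp add: cd_mem cd_inner_conj)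

lemma cd_norm_one_iff: "x \<in> \<M> n \<Longrightarrow> cd_norm x = \<one>\<^bsub>n\<^esub> \<longleftrightarrow> cd_inner x x = 1"
  by (simp add: cd_norm_def cd_mult_conj cd_scalar_inject)

lemma cd_re_mult:
  assumes "x \<in> \<M> n" "y \<in> \<M> n"
  shows "cd_re (x * y) = cd_inner x (cd_conj y)"
  using cd_inner_mult_adjoint(2)[OF assms, of "\<one>\<^bsub>n\<^esub>"] assms
  by (simp add: cd_inner_scalar cd_mult_one cd_mem)

text \<open>By adjointness (x y | y) = (x | y \<open>cd_conj y\<close>), and the last product is
  scalar. Pairing a product with one factor thus detects the real part of the other.\<close>

lemma cd_inner_mult_left:
  "x \<in> \<M> n \<Longrightarrow> y \<in> \<M> n \<Longrightarrow> cd_inner (x * y) y = cd_inner y y * cd_re x"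
  by (simp add: cd_inner_mult_adjoint(2) cd_mult_conj cd_inner_scalar)

lemma cd_inner_mult_right:
  "x \<in> \<M> n \<Longrightarrow> y \<in> \<M> n \<Longrightarrow> cd_inner (x * y) x = cd_inner x x * cd_re y"
  by (simp add: cd_inner_mult_adjoint(1) cd_conj_mult_self cd_inner_scalar)

lemma cd_inner_zero: "x \<in> \<M> n \<Longrightarrow> cd_inner \<zero>\<^bsub>n\<^esub> x = 0"
  by (simp add: cd_inner_commute[of "\<zero>\<^bsub>n\<^esub>"] cd_inner_scalar)

section \<open>Imaginary elements, anticommutation and alternation\<close>

lemma re_eq_zero_if_mult_eq_zero:
  assumes "x \<in> \<M> n" "y \<in> \<M> n" "x * y = \<zero>\<^bsub>n\<^esub>"
  shows "cd_inner y y \<noteq> 0 \<Longrightarrow> cd_re x = 0" "cd_inner x x \<noteq> 0 \<Longrightarrow> cd_re y = 0"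
  using cd_inner_mult_left[of x n y] cd_inner_mult_right[of x n y] assms
  by (auto simp: cd_inner_zero)

text \<open>The real part of x y is - (x | y) = 0, so x y is imaginary, while its conjugate is y
  x.\<close>

lemma imaginary_anticommute:
  assumes "x \<in> \<M> n" "y \<in> \<M> n" "cd_conj x = - x" "cd_conj y = - y" "cd_inner x y = 0"
  shows "y * x = - (x * y)"
proof -
  have "cd_conj (x * y) = - (x * y)"
    using assms by (subst cd_conj_eq_minus_iff) (simp add: cd_re_mult)
  then show ?thesis
    using assms by (simp add: cd_conj_mult cd_mult_minus[where n = n] cd_mem)
qed

text \<open>A unit imaginary element squares to -1, which turns alternation into x (x y) = - y.
  Conjugation gives the mirrored law.\<close>

lemma unit_imaginary_alternative:
  assumes "x \<in> \<M> n" "y \<in> \<M> n" "cd_conj x = - x" "cd_conj y = - y" "cd_inner x x = 1"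
    "(x * x) * y = x * (x * y)"
  shows "x * (x * y) = - y" "(y * x) * x = - y"
proof -
  have "x * x = - \<one>\<^bsub>n\<^esub>"
    using cd_mult_conj[of x n] assms
    by (simp add: cd_mult_minus[where n = n]) (metis cd_minus_minus cd_scalar_minus)
  then show left: "x * (x * y) = - y"
    using assms(2,6) cd_mult_minus(1)[of "\<one>\<^bsub>n\<^esub>" n y] by (simp add: cd_mult_one)
  have "cd_conj (x * (x * y)) = - ((y * x) * x)"
    using assms by (simp add: cd_conj_mult[where n = n] cd_mult_minus[where n = n] cd_mem)
  then show "(y * x) * x = - y"
    using left assms(4) by (metis cd_conj_minus cd_minus_minus)
qed

text \<open>Left multiplication by an imaginary element is skew-adjoint, so (x z | x y) = - (z | x
  (x y)) = (z | y). Alternation is required of \<open>y\<close> alone; \<open>z\<close> is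
  arbitrary.\<close>

lemma alternative_isometry:
  assumes "x \<in> \<M> n" "y \<in> \<M> n" "z \<in> \<M> n" "cd_conj x = - x" "x * (x * y) = - y"
  shows "cd_inner (x * y) (x * z) = cd_inner y z"
proof -
  have "cd_inner (x * z) (x * y) = cd_inner z (- x * (x * y))"
    using assms by (simp add: cd_inner_mult_adjoint(1)[where n = n] cd_mem)
  then show ?thesis
    using assms by (simp add: cd_mult_minus[where n = n] cd_mem cd_inner_commute)
qed


subsection \<open>The components of a pair of zero divisors\<close>

lemma zero_product_components:
  assumes mem: "a \<in> \<M> n" "b \<in> \<M> n" "c \<in> \<M> n" "d \<in> \<M> n"
    and zero: "\<langle>a, b\<rangle> * \<langle>c, d\<rangle> = \<zero>\<^bsub>Suc n\<^esub>"
    and unit: "cd_inner a a = 1" "cd_inner b b = 1" "cd_inner c c = 1" "cd_inner d d = 1"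
  shows "cd_conj a = - a" "cd_conj b = - b" "cd_conj c = - c" "cd_conj d = - d"
    and "a * c = - (d * b)" "d * a = b * c" "c * a = - (b * d)" "a * d = c * b"
proof -
  have eqs: "a * c = cd_conj d * b" "d * a = - (b * cd_conj c)"
    using zero mem by (auto simp: cd_diff_eq_zero[where n = n] cd_add_eq_zero[where n = n] cd_mem)
  \<comment> \<open>The real part of a pair is that of its first component, so the vanishing product
    in level \<open>Suc n\<close> controls \<open>a\<close> and \<open>c\<close>.\<close>
  have "cd_re a = 0" "cd_re c = 0"
    using re_eq_zero_if_mult_eq_zero[of "\<langle>a, b\<rangle>" "Suc n" "\<langle>c, d\<rangle>"] mem zero unit by auto
  then show im_ac: "cd_conj a = - a" "cd_conj c = - c"
    by (simp_all add: cd_conj_eq_minus_iff)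
  have da: "d * a = b * c"
    using eqs(2) mem by (simp add: im_ac cd_mult_minus[where n = n])
  have "cd_conj (a * c) = c * a"
    using mem by (simp add: cd_conj_mult[where n = n] im_ac cd_mult_minus[where n = n] cd_mem)
  then have ca: "c * a = cd_conj b * d"
    using mem by (simp add: eqs(1) cd_conj_mult[where n = n] cd_mem)
  \<comment> \<open>The real part of \<open>d\<close> is (d a | a); passing through both component
    equations shows that it equals its own negative. The argument for \<open>b\<close> starts from
    (b c | c).\<close>
  have "cd_re d = cd_inner (b * c) a"
    using cd_inner_mult_left[of d n a] mem unit by (simp add: da)
  also have "\<dots> = - cd_inner b (cd_conj d * b)"
    using mem by (simp add: cd_inner_mult_adjoint(2)[where n = n] im_ac cd_mult_minus[where n = n] eqs(1))
  also have "\<dots> = - cd_re d"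
    using cd_inner_mult_left[of "cd_conj d" n b] mem unit
    by (simp add: cd_inner_commute[of b "cd_conj d * b"] cd_mem)
  finally show im_d: "cd_conj d = - d"
    by (simp add: cd_conj_eq_minus_iff)
  have "cd_re b = cd_inner (d * a) c"
    using cd_inner_mult_left[of b n c] mem unit by (simp add: da)
  also have "\<dots> = - cd_inner d (cd_conj b * d)"
    using mem by (simp add: cd_inner_mult_adjoint(2)[where n = n] im_ac cd_mult_minus[where n = n] ca)
  also have "\<dots> = - cd_re b"
    using cd_inner_mult_left[of "cd_conj b" n d] mem unit
    by (simp add: cd_inner_commute[of d "cd_conj b * d"] cd_mem)
  finally show im_b: "cd_conj b = - b"
    by (simp add: cd_conj_eq_minus_iff)
  show "a * c = - (d * b)" "d * a = b * c" "c * a = - (b * d)"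
    using mem by (simp_all add: eqs(1) da ca im_b im_d cd_mult_minus[where n = n])
  have "cd_conj (d * a) = a * d" "cd_conj (b * c) = c * b"
    using mem by (simp_all add: cd_conj_mult[where n = n] im_ac im_b im_d cd_mult_minus[where n = n] cd_mem)
  then show "a * d = c * b"
    by (simp add: da)
qed

text \<open>Real parts in \<open>a * c = - (d * b)\<close> give (b | d) = - (a | c). Since left
  multiplication by \<open>c\<close> preserves (b | d), also - (a | c) = ((c b) d | c) = - (c b | c
  d) = - (b | d) = (a | c).\<close>

lemma zero_product_inner:
  assumes mem: "a \<in> \<M> n" "b \<in> \<M> n" "c \<in> \<M> n" "d \<in> \<M> n"
    and im: "cd_conj b = - b" "cd_conj c = - c" "cd_conj d = - d"
    and alt: "(a * d) * d = - a" "c * (c * b) = - b"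
    and eqs: "a * c = - (d * b)" "a * d = c * b"
  shows "cd_inner a c = 0" "cd_inner b d = 0"
proof -
  have "cd_re (a * c) = - cd_inner a c" "cd_re (d * b) = - cd_inner d b"
    using mem by (simp_all add: cd_re_mult im)
  then have bd: "cd_inner b d = - cd_inner a c"
    by (simp add: eqs(1) cd_inner_commute[of d b])
  have "- cd_inner a c = cd_inner ((c * b) * d) c"
    using alt(1) by (simp add: eqs(2))
  also have "\<dots> = - cd_inner (c * b) (c * d)"
    using mem by (simp add: cd_inner_mult_adjoint(2)[where n = n] im cd_mult_minus[where n = n] cd_mem)
  also have "\<dots> = cd_inner a c"
    using alternative_isometry[OF mem(3,2,4) im(2) alt(2)] bd by simp
  finally show "cd_inner a c = 0" by simp
  then show "cd_inner b d = 0" using bd by simp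
qed

text \<open>If two of the lines coincide, then y = r x, and (y | y) = r (x | y) = 0 contradicts
  nonzero length.\<close>

lemma cd_line_distinct:
  assumes "sorted_wrt (\<lambda>x y. cd_inner x y = 0) xs" "\<forall>x \<in> set xs. cd_inner x x \<noteq> 0"
  shows "distinct (map cd_line xs)"
  using assms
proof (induction xs)
  case (Cons x xs)
  have "cd_line x \<noteq> cd_line y" if "y \<in> set xs" for y
  proof
    have "1 *\<^sub>R y = y" by (induction y) auto
    then have "y \<in> cd_line y"
      unfolding cd_line_def by (metis (mono_tags, lifting) mem_Collect_eq)
    moreover assume "cd_line x = cd_line y"
    ultimately obtain r where "y = r *\<^sub>R x"
      by (auto simp: cd_line_def)
    then have "cd_inner y y = r * cd_inner x y"
      using cd_inner_scaleR_left by metis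
    then show False using Cons.prems that by auto
  qed
  then show ?case using Cons by auto
qed simp


subsection \<open>The double hexagon\<close>

lemma bipartite_join_K22:
  assumes "distinct [u, u', w, w']"
  shows "K\<^bsub>2,2\<^esub> (with_proj (bipartite_join {u, u'} {w, w'}))"
proof -
  have "{u, u'} \<inter> {w, w'} = {}" "card {u, u'} = 2" "card {w, w'} = 2"
    using assms by auto
  then show ?thesis
    unfolding complete_bipartite_digraph_pair_def bipartite_join_def pair_pre_digraph.simps
    by blast
qed

text \<open>Orthogonality is symmetric, so each pair yields both arcs. Distinct lines are assumed
  for consecutive corners because \<open>\<Gamma>\<^sub>O\<close> has no loops.\<close>

lemma subgraph_orthogonality_graph:
  assumes zd: "\<And>i x. i < 6 \<Longrightarrow> x \<in> V i \<Longrightarrow> two_sided_zero_divisor n x"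
    and orth: "\<And>i x y. i < 6 \<Longrightarrow> x \<in> V i \<Longrightarrow> y \<in> V (Suc i mod 6) \<Longrightarrow>
      cd_orthogonal n x y \<and> cd_line x \<noteq> cd_line y"
  shows "subgraph (with_proj (double_hexagon (\<lambda>i. cd_line ` V i))) (with_proj (\<Gamma>\<^sub>O n))"
proof -
  have "pair_wf_digraph (\<Gamma>\<^sub>O n)"
    by unfold_locales (auto simp: orthogonality_graph_def)
  moreover have "pair_wf_digraph (double_hexagon (\<lambda>i. cd_line ` V i))"
    by unfold_locales (fastforce simp: double_hexagon_def bipartite_join_def)+
  moreover have "pverts (double_hexagon (\<lambda>i. cd_line ` V i)) \<subseteq> pverts (\<Gamma>\<^sub>O n)"
  proof
    fix v assume "v \<in> pverts (double_hexagon (\<lambda>i. cd_line ` V i))"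
    then obtain i where "i < 6" "v \<in> cd_line ` V i \<union> cd_line ` V (Suc i mod 6)"
      by (auto simp: double_hexagon_def bipartite_join_def)
    then obtain j x where "j < 6" "x \<in> V j" "v = cd_line x"
      by (metis UnE imageE mod_less_divisor zero_less_numeral)
    then show "v \<in> pverts (\<Gamma>\<^sub>O n)"
      using zd unfolding orthogonality_graph_def by auto
  qed
  moreover have "parcs (double_hexagon (\<lambda>i. cd_line ` V i)) \<subseteq> parcs (\<Gamma>\<^sub>O n)"
  proof
    fix e assume "e \<in> parcs (double_hexagon (\<lambda>i. cd_line ` V i))"
    then obtain i x y where i: "i < 6" and xy: "x \<in> V i" "y \<in> V (Suc i mod 6)"
      and e: "e = (cd_line x, cd_line y) \<or> e = (cd_line y, cd_line x)"
      by (auto simp: double_hexagon_def bipartite_join_def)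
    have "two_sided_zero_divisor n x" "two_sided_zero_divisor n y" "cd_orthogonal n x y"
      "cd_orthogonal n y x" "cd_line x \<noteq> cd_line y"
      using zd[OF i xy(1)] zd[OF _ xy(2)] orth[OF i xy] by (auto simp: cd_orthogonal_def)
    then show "e \<in> parcs (\<Gamma>\<^sub>O n)"
      using e unfolding orthogonality_graph_def by auto
  qed
  ultimately show ?thesis
    by (simp add: subgraph_def compatible_def wf_digraph_wp_iff)
qed

text \<open>A single orthogonal partner witnesses both the left and the right condition.\<close>

lemma two_sided_zero_divisorI:
  assumes "x \<in> \<M> n" "y \<in> \<M> n" "cd_inner x x \<noteq> 0" "cd_inner y y \<noteq> 0" "cd_orthogonal n x y"
  shows "two_sided_zero_divisor n x"
proof -
  have "x \<noteq> \<zero>\<^bsub>n\<^esub>" "y \<noteq> \<zero>\<^bsub>n\<^esub>"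
    using assms(3,4) by (auto simp: cd_inner_zero)
  then show ?thesis
    using assms unfolding two_sided_zero_divisor_def cd_orthogonal_def by blast
qed

text \<open>Splits the cyclic index into cases in which \<open>Suc i mod 6\<close> evaluates,
  including the wrap from 5 to 0.\<close>

lemma less_six_iff: "i < 6 \<longleftrightarrow> i \<in> {0, 1, 2, 3, 4, 5 :: nat}"
  by auto

theorem mainTheorem2:
  fixes n :: nat and a b c d :: cd
  assumes "a \<in> \<M> n" and "b \<in> \<M> n" and "c \<in> \<M> n" and "d \<in> \<M> n"
    and "alternate_strongly a c" and "alternate_strongly a d"
    and "alternate_strongly b c" and "alternate_strongly b d"
    and "\<langle>a, b\<rangle> * \<langle>c, d\<rangle> = \<zero>\<^bsub>Suc n\<^esub>"
    and "cd_norm a = \<one>\<^bsub>n\<^esub>" and "cd_norm b = \<one>\<^bsub>n\<^esub>"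
    and "cd_norm c = \<one>\<^bsub>n\<^esub>" and "cd_norm d = \<one>\<^bsub>n\<^esub>"
  shows "let vs = concat (corners a b c d);
             V = (\<lambda>i. set (corners a b c d ! i));
             W = (\<lambda>i. cd_line ` V i)
         in length vs = 12 \<and> distinct (map cd_line vs)
          \<and> (\<forall>x \<in> set vs. two_sided_zero_divisor (Suc n) x
                           \<and> cd_line x \<in> pverts (\<Gamma>\<^sub>O (Suc n)))
          \<and> (\<forall>i<6. \<forall>x \<in> V i. \<forall>y \<in> V (Suc i mod 6). cd_orthogonal (Suc n) x y)
          \<and> (\<forall>i<6. K\<^bsub>2,2\<^esub> (with_proj (bipartite_join (W i) (W (Suc i mod 6)))))
          \<and> subgraph (with_proj (double_hexagon W)) (with_proj (\<Gamma>\<^sub>O (Suc n)))"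
proof -
  note mem = assms(1-4)
  have unit: "cd_inner a a = 1" "cd_inner b b = 1" "cd_inner c c = 1" "cd_inner d d = 1"
    using assms(10-13) mem by (simp_all add: cd_norm_one_iff)
  note comp = zero_product_components[OF mem assms(9) unit]
  note im = comp(1-4) and eqs = comp(5-8)
  note strong = assms(5-8)[unfolded alternate_strongly_def]
  note alt = unit_imaginary_alternative[where n = n]
  \<comment> \<open>Four alternating pairs, each in both roles and with both sided laws, give
    sixteen rules; \<open>alts(8)\<close> is (a d) d = - a and \<open>alts(11)\<close> is c (c b) =
    - b.\<close>
  note alts =
    alt[OF mem(1,3) im(1,3) unit(1) strong(1)[THEN conjunct1]]
    alt[OF mem(3,1) im(3,1) unit(3) strong(1)[THEN conjunct2]]
    alt[OF mem(1,4) im(1,4) unit(1) strong(2)[THEN conjunct1]]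
    alt[OF mem(4,1) im(4,1) unit(4) strong(2)[THEN conjunct2]]
    alt[OF mem(2,3) im(2,3) unit(2) strong(3)[THEN conjunct1]]
    alt[OF mem(3,2) im(3,2) unit(3) strong(3)[THEN conjunct2]]
    alt[OF mem(2,4) im(2,4) unit(2) strong(4)[THEN conjunct1]]
    alt[OF mem(4,2) im(4,2) unit(4) strong(4)[THEN conjunct2]]
  have perp1: "cd_inner a c = 0" "cd_inner b d = 0"
    using zero_product_inner[OF mem im(2-4) alts(8) alts(11) eqs(1) eqs(4)] .
  have perp2: "cd_inner a d = 0" "cd_inner b c = 0"
    \<comment> \<open>Replacing (c, d) by (d, -c) interchanges the two equations that the lemma
      uses, up to sign.\<close>
    using zero_product_inner[of a n b d "- c"] mem im alts eqs
    by (simp_all add: cd_mem cd_mult_minus[where n = n])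
  define p q where "p = a * c" and "q = a * d"
  have pq: "p \<in> \<M> n" "q \<in> \<M> n"
    using mem by (simp_all add: p_def q_def cd_mem)
  note neg = cd_mult_minus[where n = n]
  note anti = imaginary_anticommute[where n = n]
  \<comment> \<open>Anticommutation reduces all eight products of \<open>a\<close>, \<open>b\<close>
    with \<open>c\<close>, \<open>d\<close> to \<open>p\<close> and \<open>q\<close> up to
    sign.\<close>
  have table1: "a * c = p" "a * d = q" "b * d = p" "c * b = q"
    "c * a = - p" "d * b = - p" "b * c = - q" "d * a = - q"
    using anti[of a c] anti[of a d] anti[of b c] anti[of b d] mem im perp1 perp2 eqs
    by (auto simp: p_def q_def)
  have pq_im: "cd_conj p = - p" "cd_conj q = - q"
    using cd_re_mult[of a n c] cd_re_mult[of a n d] mem perp1 perp2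
    by (simp_all add: cd_conj_eq_minus_iff im p_def q_def)
  \<comment> \<open>Each entry is an alternation rule, with \<open>p\<close> written as a c or b d
    and \<open>q\<close> as a d or c b, up to order and sign.\<close>
  have table2: "a * p = - c" "a * q = - d" "b * p = - d" "b * q = c"
    "c * p = a" "c * q = - b" "d * p = b" "d * q = a"
    "p * a = c" "q * a = d" "p * b = d" "q * b = - c"
    "p * c = - a" "q * c = b" "p * d = - b" "q * d = - a"
    using alts mem pq by (simp_all add: table1 neg)
  note isometry = alternative_isometry[where n = n]
  \<comment> \<open>Multiplication by \<open>c\<close> sends \<open>a\<close>, \<open>b\<close> to
    -p, q, and multiplication by \<open>d\<close> sends them to -q, -p; the two values of (a | b)
    have opposite signs.\<close>
  have "cd_inner a b = - cd_inner q p"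
    using isometry[of c a b] mem im alts by (simp add: table1 cd_inner_commute)
  moreover have "cd_inner a b = cd_inner q p"
    using isometry[of d a b] mem im alts by (simp add: table1)
  ultimately have perp3: "cd_inner a b = 0" "cd_inner p q = 0"
    by (simp_all add: cd_inner_commute[of p])
  \<comment> \<open>Left multiplication by \<open>a\<close> carries \<open>c\<close>,
    \<open>d\<close> isometrically to \<open>p\<close>, \<open>q\<close>.\<close>
  have perp4: "cd_inner c d = 0" and unit_pq: "cd_inner p p = 1" "cd_inner q q = 1"
    using isometry[of a c d] isometry[of a c c] isometry[of a d d] mem im alts unit perp3
    by (simp_all add: table1)
  have re: "cd_re a = 0" "cd_re b = 0" "cd_re c = 0" "cd_re d = 0"
    using im by (simp_all add: cd_conj_eq_minus_iff)
  \<comment> \<open>A product of imaginary elements is perpendicular to both factors, and p = a c =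
    b d, q = a d = c b involve all four.\<close>
  have perp5: "cd_inner p a = 0" "cd_inner p b = 0" "cd_inner p c = 0" "cd_inner p d = 0"
      "cd_inner q a = 0" "cd_inner q b = 0" "cd_inner q c = 0" "cd_inner q d = 0"
    using cd_inner_mult_right[of a n c] cd_inner_mult_left[of a n c]
      cd_inner_mult_right[of b n d] cd_inner_mult_left[of b n d]
      cd_inner_mult_right[of a n d] cd_inner_mult_left[of a n d]
      cd_inner_mult_right[of c n b] cd_inner_mult_left[of c n b] mem re
    by (simp_all add: table1)
  note perp = perp1 perp2 perp3 perp4 perp5
  note gram = unit unit_pq perp perp[THEN trans[OF cd_inner_commute]]

  define V where "V = (\<lambda>i. set (corners a b c d ! i))"
  define vs where "vs = concat (corners a b c d)"
  have corners: "corners a b c d = [[\<langle>a, b\<rangle>, \<langle>b, - a\<rangle>], [\<langle>c, d\<rangle>, \<langle>d, - c\<rangle>], [\<langle>p, q\<rangle>, \<langle>q, - p\<rangle>],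
      [\<langle>a, - b\<rangle>, \<langle>b, a\<rangle>], [\<langle>c, - d\<rangle>, \<langle>d, c\<rangle>], [\<langle>p, - q\<rangle>, \<langle>q, p\<rangle>]]"
    by (simp add: corners_def p_def q_def)
  have vs_mem: "x \<in> \<M> (Suc n)" and vs_norm: "cd_inner x x \<noteq> 0" if "x \<in> set vs" for x
    using that mem pq by (auto simp: vs_def corners gram cd_uminus_mem)
  \<comment> \<open>In opposite corners, (a, b) and (a, -b) have inner product 1 - 1 = 0; this is
    where equal norms enter.\<close>
  have dist: "distinct (map cd_line vs)"
    by (rule cd_line_distinct) (simp_all add: vs_def corners gram)
  have orth: "cd_orthogonal (Suc n) x y" if "i < 6" "x \<in> V i" "y \<in> V (Suc i mod 6)" for i x y
    using that mem pq
    by (auto simp: less_six_iff V_def corners cd_orthogonal_def table1 table2 im pq_im neg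
        cd_diff_eq_zero[where n = n] cd_add_eq_zero[where n = n] cd_uminus_mem)
  have V_vs: "set vs = (\<Union>i<6. V i)"
    by (simp add: vs_def V_def corners lessThan_nat_numeral lessThan_Suc numeral_eq_Suc)
  have V_nonempty: "\<exists>y. y \<in> V (Suc i mod 6)" if "i < 6" for i
    using that by (auto simp: less_six_iff V_def corners)
  have zd: "two_sided_zero_divisor (Suc n) x" if i: "i < 6" and x: "x \<in> V i" for i x
  proof -
    obtain y where y: "y \<in> V (Suc i mod 6)"
      using V_nonempty[OF i] by blast
    then have "x \<in> set vs" "y \<in> set vs"
      using i x by (auto simp: V_vs)
    then show ?thesis
      using vs_mem vs_norm orth[OF i x y] two_sided_zero_divisorI by blast
  qed
  \<comment> \<open>The four lines of two consecutive corners: this gives the disjoint sides of each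
    bipartite graph and excludes loops.\<close>
  have dist4: "distinct (map cd_line (corners a b c d ! i @ corners a b c d ! (Suc i mod 6)))"
    if "i < 6" for i
    using that unfolding less_six_iff
    by (elim insertE emptyE; intro cd_line_distinct; simp add: corners gram)
  have V_pair: "\<exists>u u'. corners a b c d ! i = [u, u']" if "i < 6" for i
    using that unfolding less_six_iff by (elim insertE emptyE; simp add: corners)
  have K22: "K\<^bsub>2,2\<^esub> (with_proj (bipartite_join (cd_line ` V i) (cd_line ` V (Suc i mod 6))))"
    if i: "i < 6" for i
  proof -
    obtain u u' w w' where "corners a b c d ! i = [u, u']" "corners a b c d ! (Suc i mod 6) = [w, w']"
      using V_pair[OF i] V_pair[of "Suc i mod 6"] by auto
    then show ?thesis
      using dist4[OF i] bipartite_join_K22[of "cd_line u" "cd_line u'" "cd_line w" "cd_line w'"]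
      by (simp add: V_def)
  qed
  have "cd_line x \<noteq> cd_line y" if "i < 6" "x \<in> V i" "y \<in> V (Suc i mod 6)" for i x y
    using dist4[OF that(1)] that(2,3) by (auto simp: V_def)
  then have "subgraph (with_proj (double_hexagon (\<lambda>i. cd_line ` V i))) (with_proj (\<Gamma>\<^sub>O (Suc n)))"
    using zd orth by (intro subgraph_orthogonality_graph) auto
  moreover have "length vs = 12"
    by (simp add: vs_def corners)
  moreover have "two_sided_zero_divisor (Suc n) x \<and> cd_line x \<in> pverts (\<Gamma>\<^sub>O (Suc n))"
    if "x \<in> set vs" for x
    using that zd by (auto simp: V_vs orthogonality_graph_def)
  ultimately show ?thesis
    unfolding Let_def vs_def[symmetric] V_def[symmetric]
    by (intro conjI allI ballI impI) (use dist orth K22 in \<open>simp_all add: V_def\<close>)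
qed

end
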